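(* For every integer $d$, the family of all graphs of diameter at most $d$ is not forcing; that is, there exist graphons $U$ and $W$ that are not weakly isomorphic but satisfy $t(F,U)=t(F,W)$ for every finite graph $F$ of diameter at most $d$. In particular, the family of all complete bipartite graphs is not forcing.
   Context: A graphon is a measurable symmetric function $W:[0,1]^2\to[0,1]$ (Lebesgue measure on $[0,1]$). The homomorphism density of a graph $F$ on $\{1,\dots,k\}$ in $W$ is $t(F,W)=\int_{[0,1]^k}\prod_{\{i,j\}\in E(F)}W(x_i,x_j)\,dx_1\cdots dx_k$. The $k$-sample $\mathbb G(k,W)$ is the random graph on $\{1,\dots,k\}$ obtained by sampling $x_1,\dots,x_k\in[0,1]$ uniformly at random and making each pair $\{i,j\}$ with $i\neq j$ an edge with probability $W(x_i,x_j)$, all these choices being mutually independent. Two graphons $U,W$ are weakly isomorphic if $\mathbb G(k,U)$ and $\mathbb G(k,W)$ have the same distribution for every $k\in\mathbb N$ (equivalently, $t(H,U)=t(H,W)$ for every connected graph $H$). A family $\mathcal F$ of graphs is forcing if any two graphons $U,W$ with $t(F,U)=t(F,W)$ for all $F\in\mathcal F$ are weakly isomorphic. Graphs are finite and simple; a disconnected graph has infinite diameter, so graphs of diameter at most $d$ are connected. Complete bipartite graphs are the graphs $K_{k,\ell}$ with parts of sizes $k,\ell\ge 1$. *)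

theory Defs
  imports "HOL-Probability.Probability" "Graph_Theory.Graph_Theory"
begin

text \<open>
  Finite simple graphs are represented by the locale predicate \<^const>\<open>pair_graph\<close>:
  finitely many vertices, no loops, and a symmetric arc set, so that an edge
  \<open>{i, j}\<close> consists of the two arcs \<open>(i, j)\<close> and \<open>(j, i)\<close>. All vertices
  are natural numbers, but vertex sets need not be of the form \<open>{1..k}\<close>.
\<close>

definition graph_diameter :: "('a, 'b) pre_digraph \<Rightarrow> ereal" where
  "graph_diameter G = (SUP u\<in>verts G. SUP v\<in>verts G. wf_digraph.\<mu> G (\<lambda>_. 1) u v)"

definition graphon :: "(real \<Rightarrow> real \<Rightarrow> real) \<Rightarrow> bool" where
  "graphon W \<longleftrightarrow>
     case_prod W \<in> borel_measurable (lebesgue_on ({0..1} \<times> {0..1})) \<and>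
     (\<forall>x\<in>{0..1}. \<forall>y\<in>{0..1}. W x y \<in> {0..1} \<and> W x y = W y x)"

text \<open>
  Lebesgue measure on \<open>[0,1]\<^sup>V\<close>. The completion is needed because a graphon is only
  required to be Lebesgue measurable, and product measures are not complete.
\<close>

definition unit_cube :: "'a set \<Rightarrow> ('a \<Rightarrow> real) measure" where
  "unit_cube V = completion (\<Pi>\<^sub>M i\<in>V. restrict_space lborel {0..1})"

text \<open>
  Each edge \<open>{i, j}\<close> contributes one factor, through its arc with \<open>i < j\<close>.
\<close>

definition hom_density :: "nat pair_pre_digraph \<Rightarrow> (real \<Rightarrow> real \<Rightarrow> real) \<Rightarrow> real" where
  "hom_density F W =
     (\<integral>x. (\<Prod>(i, j)\<in>{(i, j)\<in>parcs F. i < j}. W (x i) (x j)) \<partial>unit_cube (pverts F))"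

text \<open>
  The distribution of the \<open>k\<close>-sample \<open>G(k, W)\<close>: first the points \<open>x i\<close> are drawn, then,
  given these, one independent coin \<open>b (i, j)\<close> is tossed for each pair \<open>i < j\<close>. The map
  \<open>b\<close> is \<^const>\<open>False\<close> at all other pairs.
\<close>

definition sample :: "nat \<Rightarrow> (real \<Rightarrow> real \<Rightarrow> real) \<Rightarrow> nat pair_pre_digraph measure" where
  "sample k W = unit_cube {1..k} \<bind> (\<lambda>x. measure_pmf
     (map_pmf (\<lambda>b. \<lparr>pverts = {1..k}, parcs = {(i, j). b (i, j) \<or> b (j, i)}\<rparr>)
       (Pi_pmf {(i, j). 1 \<le> i \<and> i < j \<and> j \<le> k} False
         (\<lambda>(i, j). bernoulli_pmf (W (x i) (x j))))))"

definition weakly_isomorphic ::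
    "(real \<Rightarrow> real \<Rightarrow> real) \<Rightarrow> (real \<Rightarrow> real \<Rightarrow> real) \<Rightarrow> bool" where
  "weakly_isomorphic U W \<longleftrightarrow> (\<forall>k. sample k U = sample k W)"

definition forcing :: "nat pair_pre_digraph set \<Rightarrow> bool" where
  "forcing \<F> \<longleftrightarrow>
     (\<forall>U W. graphon U \<longrightarrow> graphon W \<longrightarrow>
       (\<forall>F\<in>\<F>. hom_density F U = hom_density F W) \<longrightarrow> weakly_isomorphic U W)"

text \<open>
  The integral and the Giry bind are meaningful only for measurable arguments: for graphons,
  the integrand of \<^const>\<open>hom_density\<close> is integrable, and \<^const>\<open>sample\<close> is a probability
  measure on the discrete space of graphs. The key point is that a projection to two distinct
  coordinates pulls null sets back to null sets.
\<close>

lemma prob_space_unit_interval: "prob_space (restrict_space lborel {0..1::real})"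
  by (rule prob_spaceI) (simp add: emeasure_restrict_space)

lemma measurable_unit_cube_pair:
  assumes "i \<in> V" "j \<in> V" "i \<noteq> j"
  shows "(\<lambda>x. (x i, x j)) \<in> unit_cube V \<rightarrow>\<^sub>M lebesgue_on ({0..1} \<times> {0..1})"
proof -
  let ?I = "restrict_space lborel {0..1::real}"
  let ?P = "\<Pi>\<^sub>M i\<in>V. ?I"
  let ?f = "\<lambda>x. (x i, x j)"
  let ?D = "density lborel (indicator {0..1::real})"
  have spP: "space ?P = (\<Pi>\<^sub>E i\<in>V. {0..1})"
    by (auto simp: space_PiM space_restrict_space)
  have comp: "(\<lambda>x. x k) \<in> ?P \<rightarrow>\<^sub>M borel" if "k \<in> V" for k
  proof -
    have "(\<lambda>x. x) \<in> ?I \<rightarrow>\<^sub>M borel"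
      by (rule measurable_restrict_space1) simp
    with measurable_component_singleton[OF that] show ?thesis
      by (rule measurable_compose)
  qed
  have f: "?f \<in> ?P \<rightarrow>\<^sub>M lborel"
    using comp[OF assms(1)] comp[OF assms(2)] by (simp add: borel_measurable_Pair)
  have D: "sigma_finite_measure ?D"
    by (intro prob_space_imp_sigma_finite prob_spaceI) (simp add: emeasure_density)
  have eq: "?D \<Otimes>\<^sub>M ?D = distr ?P lborel ?f"
  proof (rule pair_measure_eqI[OF D D])
    show "sets (?D \<Otimes>\<^sub>M ?D) = sets (distr ?P lborel ?f)"
    proof -
      have "sets (?D \<Otimes>\<^sub>M ?D) = sets (lborel \<Otimes>\<^sub>M lborel)"
        by (rule sets_pair_measure_cong) (rule sets_density)+
      then show ?thesis unfolding lborel_prod sets_distr .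
    qed
    fix A B assume "A \<in> sets ?D" "B \<in> sets ?D"
    then have [measurable]: "A \<in> sets borel" "B \<in> sets borel" by auto
    let ?X = "\<lambda>k. (if k = i then A else B) \<inter> {0..1}"
    have "emeasure (distr ?P lborel ?f) (A \<times> B) = emeasure ?P (?f -` (A \<times> B) \<inter> space ?P)"
      by (rule emeasure_distr[OF f]) (simp add: borel_Times)
    also have "?f -` (A \<times> B) \<inter> space ?P = prod_emb V (\<lambda>_. ?I) {i, j} (Pi\<^sub>E {i, j} ?X)"
      using assms by (auto simp: prod_emb_def spP PiE_def Pi_def space_restrict_space)
    also have "emeasure ?P \<dots> = (\<Prod>k\<in>{i, j}. emeasure ?I (?X k))"
      by (rule emeasure_PiM_emb)
        (use assms prob_space_unit_interval in \<open>auto simp: sets_restrict_space\<close>)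
    also have "\<dots> = emeasure lborel (A \<inter> {0..1}) * emeasure lborel (B \<inter> {0..1})"
      using assms by (simp add: emeasure_restrict_space)
    also have "\<dots> = emeasure ?D A * emeasure ?D B"
    proof -
      have "emeasure ?D X = emeasure lborel (X \<inter> {0..1})" if "X \<in> sets borel" for X
        using emeasure_restricted[of "{0..1::real}" lborel X] that by (simp add: Int_commute)
      then show ?thesis by simp
    qed
    finally show "emeasure ?D A * emeasure ?D B = emeasure (distr ?P lborel ?f) (A \<times> B)" ..
  qed
  have "?D \<Otimes>\<^sub>M ?D = density (lborel \<Otimes>\<^sub>M lborel)
      (\<lambda>(x, y). indicator {0..1} x * indicator {0..1} y)"
    by (rule pair_measure_density) (auto intro: D lborel.sigma_finite_measure_axioms)
  then have dens: "distr ?P lborel ?f = density lborel (\<lambda>(x, y). indicator {0..1} x * indicator {0..1} y)"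
    unfolding eq lborel_prod .
  have null: "null_sets lborel \<subseteq> null_sets (distr ?P lborel ?f)"
  proof
    fix N :: "(real \<times> real) set" assume N: "N \<in> null_sets lborel"
    let ?g = "\<lambda>(x, y). indicator {0..1::real} x * indicator {0..1::real} y :: ennreal"
    have "?g \<in> borel_measurable lborel"
      unfolding lborel_prod[symmetric] by measurable
    then have "(N \<in> null_sets (density lborel ?g)) =
        (N \<in> sets lborel \<and> (AE p in lborel. p \<in> N \<longrightarrow> ?g p = 0))"
      by (rule null_sets_density_iff)
    moreover have "AE p in lborel. p \<in> N \<longrightarrow> ?g p = 0"
      using AE_not_in[OF N] by (rule eventually_mono) simp
    ultimately show "N \<in> null_sets (distr ?P lborel ?f)"
      unfolding dens using N by blast
  qed
  have c: "complete_measure (completion ?P)" ..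
  have f': "?f \<in> completion ?P \<rightarrow>\<^sub>M lborel" using f by (rule measurable_completion)
  have "distr (completion ?P) lborel ?f = distr ?P lborel ?f"
    using f by (rule distr_completion)
  with complete_measure.measurable_completion2[OF c f'] null
  have "?f \<in> unit_cube V \<rightarrow>\<^sub>M lebesgue" unfolding unit_cube_def by simp
  then show ?thesis
    by (rule measurable_restrict_space2[rotated])
      (use assms in \<open>auto simp: unit_cube_def spP\<close>)
qed

lemma space_unit_cube: "space (unit_cube V) = (\<Pi>\<^sub>E i\<in>V. {0..1})"
  by (auto simp: unit_cube_def space_PiM space_restrict_space)

lemma prob_space_unit_cube: "prob_space (unit_cube V)"
  unfolding unit_cube_def
  by (intro prob_space.prob_space_completion prob_space_PiM prob_space_unit_interval)

lemma graphon_measurable_unit_cube: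
  assumes "graphon W" "i \<in> V" "j \<in> V" "i \<noteq> j"
  shows "(\<lambda>x. W (x i) (x j)) \<in> borel_measurable (unit_cube V)"
  using measurable_compose[OF measurable_unit_cube_pair[OF assms(2-4)], of "case_prod W" borel]
    assms(1) by (simp add: graphon_def)

lemma hom_density_integrable:
  fixes F :: "nat pair_pre_digraph"
  assumes W: "graphon W" and F: "pair_graph F"
  shows "integrable (unit_cube (pverts F))
    (\<lambda>x. \<Prod>(i, j)\<in>{(i, j)\<in>parcs F. i < j}. W (x i) (x j))"
proof -
  interpret pair_graph F by fact
  interpret U: prob_space "unit_cube (pverts F)" by (rule prob_space_unit_cube)
  have in01: "W (x i) (x j) \<in> {0..1}" if "x \<in> space (unit_cube (pverts F))" "(i, j) \<in> parcs F" for x i j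
  proof -
    have "x i \<in> {0..1}" "x j \<in> {0..1}"
      using that in_arcsD1[of i j] in_arcsD2[of i j] by (auto simp: space_unit_cube PiE_def Pi_def)
    then show ?thesis using W by (auto simp: graphon_def)
  qed
  show ?thesis
  proof (rule U.integrable_const_bound[where B = 1])
    show "AE x in unit_cube (pverts F).
        norm (\<Prod>(i, j)\<in>{(i, j)\<in>parcs F. i < j}. W (x i) (x j)) \<le> 1"
      using in01 by (intro AE_I2) (auto simp: abs_prod intro!: prod_le_1)
    show "(\<lambda>x. \<Prod>(i, j)\<in>{(i, j)\<in>parcs F. i < j}. W (x i) (x j))
        \<in> borel_measurable (unit_cube (pverts F))"
      by (rule borel_measurable_prod)
        (auto intro!: graphon_measurable_unit_cube[OF W] dest: in_arcsD1 in_arcsD2)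
  qed
qed

lemma sample_kernel_measurable:
  fixes k :: nat
  assumes W: "graphon W"
  shows "(\<lambda>x. measure_pmf
     (map_pmf (\<lambda>b. \<lparr>pverts = {1..k}, parcs = {(i, j). b (i, j) \<or> b (j, i)}\<rparr>)
       (Pi_pmf {(i, j). 1 \<le> i \<and> i < j \<and> j \<le> k} False
         (\<lambda>(i, j). bernoulli_pmf (W (x i) (x j))))))
    \<in> unit_cube {1..k} \<rightarrow>\<^sub>M prob_algebra (count_space UNIV)"
    (is "(\<lambda>x. measure_pmf (map_pmf ?h (Pi_pmf ?E False (?p x)))) \<in> _")
proof -
  let ?C = "unit_cube {1..k}"
  have finE: "finite ?E"
    by (rule finite_subset[of _ "{1..k} \<times> {1..k}"]) auto
  let ?S = "PiE_dflt ?E False (\<lambda>_. UNIV)"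
  have finS: "finite ?S" using finE by (intro finite_PiE_dflt) auto
  have in01: "0 \<le> W (x i) (x j) \<and> W (x i) (x j) \<le> 1" if "x \<in> space ?C" "(i, j) \<in> ?E" for x i j
  proof -
    have "x i \<in> {0..1}" "x j \<in> {0..1}"
      using that by (auto simp: space_unit_cube PiE_def Pi_def)
    then show ?thesis using W by (auto simp: graphon_def)
  qed
  have pm: "(\<lambda>x. pmf (?p x e) c) \<in> borel_measurable ?C" if e: "e \<in> ?E" for e c
  proof -
    obtain i j where ij: "e = (i, j)" by force
    have "(\<lambda>x. if c then W (x i) (x j) else 1 - W (x i) (x j)) \<in> borel_measurable ?C"
      using graphon_measurable_unit_cube[OF W, of i "{1..k}" j] e ij by auto
    also have "?this \<longleftrightarrow> ?thesis"
      using e ij in01 by (intro measurable_cong) (cases c; auto)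
    finally show ?thesis .
  qed
  show ?thesis
  proof (rule measurable_prob_algebraI)
    show "prob_space (measure_pmf (map_pmf ?h (Pi_pmf ?E False (?p x))))" for x
      by (rule measure_pmf.prob_space_axioms)
    show "(\<lambda>x. measure_pmf (map_pmf ?h (Pi_pmf ?E False (?p x))))
        \<in> ?C \<rightarrow>\<^sub>M subprob_algebra (count_space UNIV)"
    proof (rule measurable_subprob_algebra)
      show "subprob_space (measure_pmf (map_pmf ?h (Pi_pmf ?E False (?p x))))" for x
        by (rule measure_pmf.subprob_space_axioms)
      show "sets (measure_pmf (map_pmf ?h (Pi_pmf ?E False (?p x)))) = sets (count_space UNIV)" for x
        by simp
      fix A
      have "emeasure (measure_pmf (map_pmf ?h (Pi_pmf ?E False (?p x)))) A
          = ennreal (\<Sum>b\<in>?S \<inter> ?h -` A. \<Prod>e\<in>?E. pmf (?p x e) (b e))" for x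
      proof -
        let ?Q = "Pi_pmf ?E False (?p x)"
        have "set_pmf ?Q \<subseteq> ?S"
          using set_Pi_pmf_subset[OF finE, of False "?p x"] unfolding PiE_dflt_def by blast
        then have "emeasure ?Q (?h -` A) = emeasure ?Q (?S \<inter> ?h -` A)"
          by (intro emeasure_eq_AE) (auto simp: AE_measure_pmf_iff)
        also have "\<dots> = ennreal (\<Sum>b\<in>?S \<inter> ?h -` A. pmf ?Q b)"
          by (rule emeasure_measure_pmf_finite) (rule finite_Int[OF disjI1[OF finS]])
        also have "(\<Sum>b\<in>?S \<inter> ?h -` A. pmf ?Q b) = (\<Sum>b\<in>?S \<inter> ?h -` A. \<Prod>e\<in>?E. pmf (?p x e) (b e))"
        proof (rule sum.cong[OF refl])
          fix b assume "b \<in> ?S \<inter> ?h -` A"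
          then have "b e = False" if "e \<notin> ?E" for e
            using that unfolding PiE_dflt_def by blast
          then show "pmf ?Q b = (\<Prod>e\<in>?E. pmf (?p x e) (b e))"
            by (rule pmf_Pi'[OF finE])
        qed
        finally show ?thesis unfolding emeasure_map_pmf .
      qed
      moreover have "(\<lambda>x. ennreal (\<Sum>b\<in>?S \<inter> ?h -` A. \<Prod>e\<in>?E. pmf (?p x e) (b e)))
          \<in> borel_measurable ?C"
        by (intro measurable_compose[OF _ measurable_ennreal] borel_measurable_sum
            borel_measurable_prod pm)
      ultimately show "(\<lambda>x. emeasure (measure_pmf (map_pmf ?h (Pi_pmf ?E False (?p x)))) A)
          \<in> borel_measurable ?C"
        by (simp only:)
    qed
  qed
qed

lemma sample_prob_algebra:
  assumes "graphon W"
  shows "sample k W \<in> space (prob_algebra (count_space UNIV))"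
proof -
  have "unit_cube {1..k} \<in> space (prob_algebra (unit_cube {1..k}))"
    by (simp add: space_prob_algebra prob_space_unit_cube)
  from prob_space_bind'[OF this sample_kernel_measurable[OF assms]]
    sets_bind'[OF this sample_kernel_measurable[OF assms]]
  show ?thesis
    unfolding sample_def by (simp only: space_prob_algebra mem_Collect_eq)
qed

end

theory Submission
  imports Defs "HOL-Number_Theory.Cong"
begin

text \<open>
  Let \<open>m = 2 D + 3\<close> and \<open>n = 2 m\<close>. The step graphons of the Cayley graphs of \<open>\<int>/n\<close> with
  connection sets \<open>{1, -1}\<close> (a cycle of length \<open>n\<close>) and \<open>{2, -2}\<close> (two disjoint cycles of
  length \<open>m\<close>) have the same density of every graph \<open>F\<close> of diameter at most \<open>D\<close>: the image of
  \<open>F\<close> under a homomorphism lies within distance \<open>D\<close> of the image of a root, and there the two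
  Cayley graphs look alike. The cycle of odd length \<open>m\<close> maps into the second but not into the first
  Cayley graph, so the two graphons are not weakly isomorphic.
\<close>

section \<open>Subgraph probabilities in samples\<close>

lemma prob_Pi_pmf_bernoulli_all:
  assumes "finite A" "S \<subseteq> A" "\<And>e. e \<in> S \<Longrightarrow> p e \<in> {0..1}"
  shows "measure_pmf.prob (Pi_pmf A False (\<lambda>e. bernoulli_pmf (p e))) {b. \<forall>e\<in>S. b e} = (\<Prod>e\<in>S. p e)"
proof -
  let ?B = "\<lambda>e. if e \<in> S then {True} else UNIV"
  have "measure_pmf.prob (Pi_pmf A False (\<lambda>e. bernoulli_pmf (p e))) (Pi A ?B)
      = (\<Prod>e\<in>A. measure_pmf.prob (bernoulli_pmf (p e)) (?B e))"
    by (rule measure_Pi_pmf_Pi[OF assms(1)])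
  also have "\<dots> = (\<Prod>e\<in>A. if e \<in> S then p e else 1)"
    using assms(3) by (intro prod.cong) (auto simp: measure_pmf_single)
  also have "\<dots> = (\<Prod>e\<in>S. p e)"
    using assms(1,2) by (simp add: prod.If_cases Int_absorb1)
  also have "Pi A ?B = {b. \<forall>e\<in>S. b e}"
    using assms(2) by (auto simp: Pi_def split: if_splits)
  finally show ?thesis .
qed

text \<open>Given the points \<open>x\<close>, the coins of the edges of \<open>F\<close> are
  independent, so the conditional probability that the sample contains \<open>F\<close> is the
  integrand of \<open>hom_density\<close>. Averaging over \<open>x\<close> makes the density an
  observable of the sample distribution.\<close>

lemma emeasure_sample_supergraphs:
  assumes W: "graphon W" and F: "pair_graph F" and V: "pverts F = {1..k}"
  shows "emeasure (sample k W) {G. parcs F \<subseteq> parcs G} = ennreal (hom_density F W)"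
proof -
  interpret pair_graph F by fact
  let ?A = "{G :: nat pair_pre_digraph. parcs F \<subseteq> parcs G}"
  let ?E = "{(i, j). 1 \<le> i \<and> i < j \<and> j \<le> k}"
  let ?S = "{(i, j)\<in>parcs F. i < j}"
  let ?h = "\<lambda>b. \<lparr>pverts = {1..k}, parcs = {(i, j). b (i, j) \<or> b (j, i)}\<rparr>"
  let ?K = "\<lambda>x. measure_pmf (map_pmf ?h
      (Pi_pmf ?E False (\<lambda>(i, j). bernoulli_pmf (W (x i) (x j)))))"
  let ?f = "\<lambda>x. \<Prod>(i, j)\<in>?S. W (x i) (x j)"
  have finE: "finite ?E"
    by (rule finite_subset[of _ "{1..k} \<times> {1..k}"]) auto
  have SE: "?S \<subseteq> ?E"
    using in_arcsD1 in_arcsD2 V by fastforce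
  have in01: "W (x i) (x j) \<in> {0..1}" if "x \<in> space (unit_cube {1..k})" "(i, j) \<in> ?S" for x i j
  proof -
    have "x i \<in> {0..1}" "x j \<in> {0..1}"
      using that SE by (auto simp: space_unit_cube PiE_def Pi_def)
    then show ?thesis using W by (auto simp: graphon_def)
  qed
  have K: "emeasure (?K x) ?A = ennreal (?f x)" if x: "x \<in> space (unit_cube {1..k})" for x
  proof -
    let ?P = "Pi_pmf ?E False (\<lambda>e. bernoulli_pmf (case e of (i, j) \<Rightarrow> W (x i) (x j)))"
    \<comment> \<open>Almost surely \<open>b\<close> is \<open>False\<close> outside
      \<open>?E\<close>, so of \<open>b (i, j)\<close> and \<open>b (j, i)\<close> only the one with
      increasing indices can hold.\<close>
    have "AE b in ?P. ?h b \<in> ?A \<longleftrightarrow> b \<in> {b. \<forall>e\<in>?S. b e}"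
      unfolding AE_measure_pmf_iff
    proof
      fix b assume "b \<in> set_pmf ?P"
      from subsetD[OF set_Pi_pmf_subset[OF finE] this]
      have b: "\<forall>e. e \<notin> ?E \<longrightarrow> b e = False" by (rule CollectD)
      show "?h b \<in> ?A \<longleftrightarrow> b \<in> {b. \<forall>e\<in>?S. b e}"
      proof
        assume h: "?h b \<in> ?A"
        have "b (i, j)" if "(i, j) \<in> ?S" for i j
        proof -
          have "b (i, j) \<or> b (j, i)" using h that by auto
          moreover have "\<not> b (j, i)" using mp[OF spec[OF b, of "(j, i)"]] that by simp
          ultimately show ?thesis by blast
        qed
        then show "b \<in> {b. \<forall>e\<in>?S. b e}" by blast
      next
        assume S: "b \<in> {b. \<forall>e\<in>?S. b e}"
        have "b (i, j) \<or> b (j, i)" if ij: "(i, j) \<in> parcs F" for i j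
        proof (cases i j rule: linorder_cases)
          case less
          then show ?thesis using S ij by blast
        next
          case equal
          then show ?thesis using no_loops'[OF ij] by blast
        next
          case greater
          then show ?thesis using S arcs_symmetric[OF ij] by blast
        qed
        then show "?h b \<in> ?A" by auto
      qed
    qed
    then have "emeasure ?P (?h -` ?A) = emeasure ?P {b. \<forall>e\<in>?S. b e}"
      by (intro emeasure_eq_AE) auto
    also have "\<dots> = ennreal (?f x)"
      unfolding measure_pmf.emeasure_eq_measure
      using in01[OF x] by (subst prob_Pi_pmf_bernoulli_all[OF finE SE]) auto
    finally show ?thesis
      by (simp add: case_prod_unfold)
  qed
  have "emeasure (sample k W) ?A = (\<integral>\<^sup>+x. emeasure (?K x) ?A \<partial>unit_cube {1..k})"
    unfolding sample_def
  proof (rule emeasure_bind)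
    show "space (unit_cube {1..k}) \<noteq> {}"
      by (rule prob_space.not_empty[OF prob_space_unit_cube])
    show "?K \<in> unit_cube {1..k} \<rightarrow>\<^sub>M subprob_algebra (count_space UNIV)"
      by (rule measurable_prob_algebraD[OF sample_kernel_measurable[OF W]])
  qed simp
  also have "\<dots> = (\<integral>\<^sup>+x. ennreal (?f x) \<partial>unit_cube {1..k})"
    by (rule nn_integral_cong) (rule K)
  also have "\<dots> = ennreal (hom_density F W)"
    unfolding hom_density_def V
  proof (rule nn_integral_eq_integral)
    show "integrable (unit_cube {1..k}) ?f"
      using hom_density_integrable[OF W F] V by simp
    show "AE x in unit_cube {1..k}. 0 \<le> ?f x"
      using in01 by (intro AE_I2 prod_nonneg) auto
  qed
  finally show ?thesis .
qed

lemma hom_density_nonneg: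
  assumes W: "graphon W" and F: "pair_graph F"
  shows "0 \<le> hom_density F W"
proof -
  interpret pair_graph F by fact
  have "0 \<le> W (x i) (x j)" if "x \<in> space (unit_cube (pverts F))" "(i, j) \<in> parcs F" for x i j
  proof -
    have "x i \<in> {0..1}" "x j \<in> {0..1}"
      using that in_arcsD1[of i j] in_arcsD2[of i j] by (auto simp: space_unit_cube PiE_def Pi_def)
    then show ?thesis using W by (auto simp: graphon_def)
  qed
  then show ?thesis
    unfolding hom_density_def by (intro integral_nonneg_AE AE_I2 prod_nonneg) auto
qed

lemma weakly_isomorphic_hom_density:
  assumes "weakly_isomorphic U W" "graphon U" "graphon W" "pair_graph F" "pverts F = {1..k}"
  shows "hom_density F U = hom_density F W"
proof -
  have "ennreal (hom_density F U) = ennreal (hom_density F W)"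
    using assms(1) emeasure_sample_supergraphs[OF assms(2,4,5)]
      emeasure_sample_supergraphs[OF assms(3,4,5)] by (simp add: weakly_isomorphic_def)
  then show ?thesis
    using hom_density_nonneg assms(2-4) by simp
qed

section \<open>Step graphons of graphs on residues\<close>

text \<open>Reduction modulo \<open>n\<close> only serves to put the point \<open>x = 1\<close> into a block.\<close>

definition block :: "int \<Rightarrow> real \<Rightarrow> int" where
  "block n x = \<lfloor>of_int n * x\<rfloor> mod n"

definition step_graphon :: "int \<Rightarrow> (int \<Rightarrow> int \<Rightarrow> bool) \<Rightarrow> real \<Rightarrow> real \<Rightarrow> real" where
  "step_graphon n R x y = of_bool (R (block n x) (block n y))"

text \<open>Extensional functions make each map on the vertices count exactly once, so that
  \<open>card\<close> is the number of homomorphisms.\<close>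

definition homs :: "'a pair_pre_digraph \<Rightarrow> int \<Rightarrow> (int \<Rightarrow> int \<Rightarrow> bool) \<Rightarrow> ('a \<Rightarrow> int) set" where
  "homs F n R = {a \<in> pverts F \<rightarrow>\<^sub>E {0..<n}. \<forall>(i, j)\<in>parcs F. R (a i) (a j)}"

lemma measurable_block [measurable]: "block n \<in> borel \<rightarrow>\<^sub>M count_space UNIV"
  unfolding block_def by measurable

lemma block_in: "n > 0 \<Longrightarrow> block n x \<in> {0..<n}"
  by (simp add: block_def)

lemma graphon_step_graphon:
  assumes "symp R"
  shows "graphon (step_graphon n R)"
proof -
  have "case_prod (step_graphon n R) \<in> borel_measurable (borel \<Otimes>\<^sub>M borel)"
    unfolding step_graphon_def case_prod_unfold by measurable
  then have "case_prod (step_graphon n R) \<in> borel_measurable borel"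
    unfolding borel_prod .
  then have "case_prod (step_graphon n R) \<in> borel_measurable (lebesgue_on ({0..1} \<times> {0..1}))"
    by (intro measurable_restrict_space1 measurable_completion) simp
  then show ?thesis
    using assms by (auto simp: graphon_def step_graphon_def dest: sympD)
qed

lemma emeasure_block:
  assumes n: "n > 0" and k: "k \<in> {0..<n}"
  shows "emeasure (restrict_space lborel {0..1}) (block n -` {k} \<inter> {0..1}) = ennreal (1 / of_int n)"
proof -
  let ?I = "{of_int k / of_int n ..< (of_int k + 1) / of_int n :: real}"
  \<comment> \<open>At \<open>x = 1\<close> the reduction modulo \<open>n\<close> gives block 0, so
    the block and the half-open interval agree only up to this null set.\<close>
  have "x \<in> ?I \<longleftrightarrow> block n x = k \<and> x \<in> {0..1}" if "x \<noteq> 1" for x :: real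
  proof
    assume x: "x \<in> ?I"
    have "of_int (k + 1) \<le> (of_int n :: real)" using k by (simp only: of_int_le_iff) simp
    then have "(of_int k + 1) / of_int n \<le> (1 :: real)" using n by simp
    moreover have "0 \<le> of_int k / (of_int n :: real)" using n k by simp
    ultimately have "x \<in> {0..1}" using x by auto
    moreover have "\<lfloor>of_int n * x\<rfloor> = k"
      using x n by (intro floor_unique) (auto simp: field_simps)
    ultimately show "block n x = k \<and> x \<in> {0..1}"
      using k by (simp add: block_def)
  next
    assume x: "block n x = k \<and> x \<in> {0..1}"
    then have "0 \<le> of_int n * x" "of_int n * x < of_int n" using n that by auto
    then have "\<lfloor>of_int n * x\<rfloor> = k" using x by (simp add: block_def floor_less_iff)
    then have "of_int k \<le> of_int n * x" "of_int n * x < of_int k + 1" by linarith+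
    then show "x \<in> ?I" using n by (auto simp: field_simps)
  qed
  then have eq: "x \<in> block n -` {k} \<inter> {0..1} \<longleftrightarrow> x \<in> ?I" if "x \<noteq> 1" for x
    using that by auto
  have [measurable]: "block n -` {k} \<in> sets borel"
    using measurable_sets[OF measurable_block, of "{k}" n] by simp
  have "emeasure (restrict_space lborel {0..1}) (block n -` {k} \<inter> {0..1})
      = emeasure lborel (block n -` {k} \<inter> {0..1})"
    by (rule emeasure_restrict_space) auto
  also have "\<dots> = emeasure lborel ?I"
    by (rule emeasure_eq_AE) (use AE_lborel_singleton[of "1 :: real"] eq in \<open>auto elim!: eventually_mono\<close>)
  also have "\<dots> = ennreal (1 / of_int n)"
    using n by (simp add: divide_right_mono flip: diff_divide_distrib)
  finally show ?thesis .
qed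

text \<open>The cube splits into boxes indexed by the block vectors \<open>a\<close>, all of volume
  \<open>1 / n ^ card V\<close>, and the integrand is constant on each.\<close>

lemma integral_step_function:
  fixes g :: "('a \<Rightarrow> int) \<Rightarrow> real"
  assumes V: "finite V" and n: "n > 0"
  shows "(\<integral>x. g (\<lambda>i\<in>V. block n (x i)) \<partial>unit_cube V) = (\<Sum>a\<in>V \<rightarrow>\<^sub>E {0..<n}. g a) / of_int n ^ card V"
proof -
  let ?M = "restrict_space lborel {0..1::real}"
  let ?A = "V \<rightarrow>\<^sub>E {0..<n}"
  let ?B = "\<lambda>a. Pi\<^sub>E V (\<lambda>i. block n -` {a i} \<inter> {0..1})"
  interpret prob_space "unit_cube V" by (rule prob_space_unit_cube)
  have [measurable]: "block n -` {k} \<in> sets borel" for k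
    using measurable_sets[OF measurable_block, of "{k}" n] by simp
  have spM: "space ?M = {0..1}" by (simp add: space_restrict_space)
  have setsM: "block n -` {k} \<inter> {0..1} \<in> sets ?M" for k
    by (auto simp: sets_restrict_space Int_commute)
  have finA: "finite ?A" using V by (intro finite_PiE) auto
  have B: "?B a \<in> sets (\<Pi>\<^sub>M i\<in>V. ?M)" for a
    using V setsM by (intro sets_PiM_I_finite) auto
  have emB: "emeasure (unit_cube V) (?B a) = ennreal (1 / of_int n ^ card V)" if "a \<in> ?A" for a
  proof -
    have "prod_emb V (\<lambda>_. ?M) V (?B a) = ?B a"
      by (rule prod_emb_PiE_same_index) (simp add: spM)
    then have "emeasure (unit_cube V) (?B a) = emeasure (\<Pi>\<^sub>M i\<in>V. ?M) (prod_emb V (\<lambda>_. ?M) V (?B a))"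
      unfolding unit_cube_def using B by simp
    also have "\<dots> = (\<Prod>i\<in>V. emeasure ?M (block n -` {a i} \<inter> {0..1}))"
      using V setsM by (intro emeasure_PiM_emb prob_space_unit_interval) auto
    also have "\<dots> = (\<Prod>i\<in>V. ennreal (1 / of_int n))"
      by (rule prod.cong[OF refl], rule emeasure_block[OF n]) (use that in auto)
    also have "\<dots> = ennreal (1 / of_int n ^ card V)"
      using n by (simp add: ennreal_power power_one_over)
    finally show ?thesis .
  qed
  have B': "?B a \<in> sets (unit_cube V)" for a
    using B unfolding unit_cube_def by simp
  have "(\<integral>x. g (\<lambda>i\<in>V. block n (x i)) \<partial>unit_cube V) = (\<integral>x. (\<Sum>a\<in>?A. indicator (?B a) x * g a) \<partial>unit_cube V)"
  proof (rule Bochner_Integration.integral_cong[OF refl])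
    fix x assume x: "x \<in> space (unit_cube V)"
    let ?a = "\<lambda>i\<in>V. block n (x i)"
    \<comment> \<open>Each point lies in the box of its own block vector and in no other, so the sum
      of indicators has a single nonzero term.\<close>
    have ind: "x \<in> ?B a \<longleftrightarrow> a = ?a" if "a \<in> ?A" for a
      using that x by (auto simp: space_unit_cube PiE_iff extensional_def fun_eq_iff)
    have aA: "?a \<in> ?A" using block_in[OF n] by auto
    have "(\<Sum>a\<in>?A. indicator (?B a) x * g a) = (\<Sum>a\<in>?A. if a = ?a then g a else 0)"
      by (rule sum.cong[OF refl]) (simp only: ind indicator_def of_bool_def mult_1_left mult_zero_left if_distribR split: if_split, simp)
    also have "\<dots> = g ?a"
      by (simp only: sum.delta[OF finA] aA if_True)
    finally show "g ?a = (\<Sum>a\<in>?A. indicator (?B a) x * g a)" ..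
  qed
  also have "\<dots> = (\<Sum>a\<in>?A. \<integral>x. indicator (?B a) x * g a \<partial>unit_cube V)"
    by (rule Bochner_Integration.integral_sum)
      (intro integrable_mult_left integrable_real_indicator B', simp add: emeasure_eq_measure)
  also have "\<dots> = (\<Sum>a\<in>?A. measure (unit_cube V) (?B a) * g a)"
    by (rule sum.cong[OF refl]) (simp only: integral_mult_left_zero Bochner_Integration.integral_indicator sets.Int_space_eq2[OF B'])
  also have "\<dots> = (\<Sum>a\<in>?A. 1 / of_int n ^ card V * g a)"
    by (rule sum.cong[OF refl]) (use n in \<open>simp add: measure_def emB\<close>)
  finally show ?thesis
    by (simp add: sum_divide_distrib)
qed

text \<open>For a 0/1-valued step graphon the integrand is the indicator that the block vector is a
  homomorphism, so the density is a normalised count.\<close>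

lemma hom_density_step_graphon:
  assumes F: "pair_graph F" and R: "symp R" and n: "n > 0"
  shows "hom_density F (step_graphon n R) = card (homs F n R) / of_int n ^ card (pverts F)"
proof -
  interpret pair_graph F by fact
  let ?S = "{(i, j)\<in>parcs F. i < j}"
  let ?g = "\<lambda>a. \<Prod>(i, j)\<in>?S. of_bool (R (a i) (a j)) :: real"
  have finA: "finite (pverts F \<rightarrow>\<^sub>E {0..<n})" by (intro finite_PiE) auto
  have finS: "finite ?S" by (rule finite_subset[OF _ pair_finite_arcs]) auto
  have "(\<Prod>(i, j)\<in>?S. step_graphon n R (x i) (x j)) = ?g (\<lambda>i\<in>pverts F. block n (x i))" for x
  proof (rule prod.cong[OF refl])
    fix e assume e: "e \<in> ?S"
    then obtain i j where "e = (i, j)" "i \<in> pverts F" "j \<in> pverts F"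
      using in_arcsD1 in_arcsD2 by blast
    then show "(case e of (i, j) \<Rightarrow> step_graphon n R (x i) (x j))
        = (case e of (i, j) \<Rightarrow> of_bool (R ((\<lambda>i\<in>pverts F. block n (x i)) i) ((\<lambda>i\<in>pverts F. block n (x i)) j)))"
      by (simp add: step_graphon_def)
  qed
  then have "hom_density F (step_graphon n R)
      = (\<integral>x. ?g (\<lambda>i\<in>pverts F. block n (x i)) \<partial>unit_cube (pverts F))"
    unfolding hom_density_def by (simp only:)
  also have "\<dots> = (\<Sum>a\<in>pverts F \<rightarrow>\<^sub>E {0..<n}. ?g a) / of_int n ^ card (pverts F)"
    by (rule integral_step_function) (simp_all add: n)
  also have "(\<Sum>a\<in>pverts F \<rightarrow>\<^sub>E {0..<n}. ?g a)
      = (\<Sum>a\<in>pverts F \<rightarrow>\<^sub>E {0..<n}. of_bool (a \<in> homs F n R))"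
  proof (rule sum.cong[OF refl])
    fix a assume a: "a \<in> pverts F \<rightarrow>\<^sub>E {0..<n}"
    have "?g a = of_bool (\<forall>(i, j)\<in>?S. R (a i) (a j))"
      using finS by (induction ?S rule: infinite_finite_induct) (auto simp: case_prod_unfold)
    \<comment> \<open>Symmetry of \<open>R\<close> and the absence of loops extend the condition
      from arcs with \<open>i < j\<close> to all arcs.\<close>
    also have "(\<forall>(i, j)\<in>?S. R (a i) (a j)) \<longleftrightarrow> (\<forall>(i, j)\<in>parcs F. R (a i) (a j))"
    proof safe
      fix i j assume *: "\<forall>(i, j)\<in>?S. R (a i) (a j)" "(i, j) \<in> parcs F"
      then show "R (a i) (a j)"
        using arcs_symmetric[of i j] no_loops'[of i j] sympD[OF R, of "a j" "a i"]
        by (cases "i < j") auto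
    qed auto
    finally show "?g a = of_bool (a \<in> homs F n R)"
      using a by (simp add: homs_def)
  qed
  also have "\<dots> = card (homs F n R)"
  proof -
    have "(pverts F \<rightarrow>\<^sub>E {0..<n}) \<inter> {a. a \<in> homs F n R} = homs F n R"
      by (auto simp: homs_def)
    then show ?thesis
      using finA by simp
  qed
  finally show ?thesis .
qed

section \<open>Homomorphisms into circulant graphs\<close>

text \<open>Congruences allow arbitrary integer arguments, so values such as
  \<open>a r + 2 * t\<close> need no reduction to a representative.\<close>

definition circulant :: "int \<Rightarrow> int \<Rightarrow> int \<Rightarrow> int \<Rightarrow> bool" where
  "circulant n s a b \<longleftrightarrow> [a - b = s] (mod n) \<or> [a - b = - s] (mod n)"

lemma symp_circulant: "symp (circulant n s)"
proof (rule sympI)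
  fix a b assume "circulant n s a b"
  then have "[- (a - b) = - s] (mod n) \<or> [- (a - b) = - (- s)] (mod n)"
    unfolding circulant_def cong_minus_minus_iff .
  then show "circulant n s b a"
    by (auto simp: circulant_def)
qed

lemma circulant_cong:
  assumes "[a = a'] (mod n)" "[b = b'] (mod n)"
  shows "circulant n s a b \<longleftrightarrow> circulant n s a' b'"
  using cong_diff[OF assms] unfolding circulant_def cong_def by simp

text \<open>Each arc changes the value by \<open>s\<close> or \<open>- s\<close> modulo
  \<open>n\<close>; \<open>t\<close> is the signed number of these changes.\<close>

lemma (in pair_wf_digraph) circulant_hom_walk:
  assumes "awalk u p v" and hom: "\<forall>(i, j)\<in>parcs G. circulant n s (a i) (a j)"
  shows "\<exists>t. \<bar>t\<bar> \<le> int (length p) \<and> [a v - a u = s * t] (mod n)"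
  using assms(1)
proof (induction p arbitrary: u)
  case Nil
  then show ?case by (auto simp: awalk_Nil_iff)
next
  case (Cons e p)
  then have e: "e \<in> parcs G" "u = fst e" "awalk (snd e) p v"
    by (auto simp: awalk_Cons_iff)
  from Cons.IH[OF e(3)] obtain t where t: "\<bar>t\<bar> \<le> int (length p)" "[a v - a (snd e) = s * t] (mod n)"
    by blast
  have "circulant n s (a u) (a (snd e))"
    using hom e by auto
  then obtain c where c: "\<bar>c\<bar> = 1" "[a u - a (snd e) = s * c] (mod n)"
    unfolding circulant_def by (metis abs_1 abs_minus_cancel mult.right_neutral mult_minus_right)
  have "[a v - a u = s * (t - c)] (mod n)"
    using cong_diff[OF t(2) c(2)] by (simp add: algebra_simps)
  moreover have "\<bar>t - c\<bar> \<le> int (length (e # p))"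
    using t(1) c(1) by auto
  ultimately show ?case by blast
qed

section \<open>A permutation of the residues that doubles near zero\<close>

text \<open>
  Doubling is not injective modulo \<open>2 m\<close>; adding \<open>1\<close> on the half of the residues that is far from
  \<open>0\<close> makes it a permutation.
\<close>

definition double_near :: "int \<Rightarrow> int \<Rightarrow> int" where
  "double_near D z = (if (z + D + 1) mod (2 * (2 * D + 3)) < 2 * D + 3 then 2 * z else 2 * z + 1)"

text \<open>The shift by \<open>D + 1\<close> moves \<open>t\<close> into the range from 1 to
  \<open>2 * D + 1\<close>, which lies in the first half of the residues.\<close>

lemma double_near_eq: "\<bar>t\<bar> \<le> D \<Longrightarrow> double_near D t = 2 * t"
  by (simp add: double_near_def)

text \<open>As the modulus is even, the parity of the value reveals which half the argument lies in.
  Doubling determines the argument modulo \<open>2 * D + 3\<close>, and a half consists of that many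
  consecutive residues, so the argument is determined.\<close>

lemma double_near_cong_iff:
  assumes "D \<ge> 0"
  shows "[double_near D y = double_near D z] (mod 2 * (2 * D + 3)) \<longleftrightarrow> [y = z] (mod 2 * (2 * D + 3))"
proof
  let ?m = "2 * D + 3"
  let ?r = "\<lambda>x. (x + D + 1) mod (2 * ?m)"
  assume "[y = z] (mod 2 * ?m)"
  then have "[y + D + 1 = z + D + 1] (mod 2 * ?m)" "[2 * y = 2 * z] (mod 2 * ?m)"
      "[2 * y + 1 = 2 * z + 1] (mod 2 * ?m)"
    by (intro cong_add cong_mult cong_refl; assumption)+
  moreover from this(1) have "?r y = ?r z" by (simp only: cong_def)
  ultimately show "[double_near D y = double_near D z] (mod 2 * ?m)"
    unfolding double_near_def by simp
next
  let ?m = "2 * D + 3"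
  let ?r = "\<lambda>x. (x + D + 1) mod (2 * ?m)"
  assume "[double_near D y = double_near D z] (mod 2 * ?m)"
  then have dvd: "2 * ?m dvd double_near D y - double_near D z"
    by (simp only: cong_iff_dvd_diff)
  then have "even (double_near D y - double_near D z)"
    by (rule dvd_mult_left)
  then have half: "?r y < ?m \<longleftrightarrow> ?r z < ?m"
    by (auto simp: double_near_def split: if_splits)
  then have "2 * ?m dvd 2 * (y - z)"
    using dvd by (auto simp: double_near_def algebra_simps split: if_splits)
  then have yz: "?m dvd y - z" by (simp only: dvd_mult_cancel_left) simp
  have r: "?m dvd ?r x - (x + D + 1)" for x
    using dvd_mult_right[of 2 ?m] by (simp add: mod_eq_dvd_iff[symmetric] mod_mod_cancel)
  have "?m dvd (?r y - (y + D + 1)) - (?r z - (z + D + 1)) + (y - z)"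
    by (rule dvd_add[OF dvd_diff[OF r r] yz])
  then have "?m dvd ?r y - ?r z" by (simp add: algebra_simps)
  \<comment> \<open>Both shifted residues lie in the same half, an interval of length
    \<open>?m\<close>; being congruent modulo \<open>?m\<close>, they coincide.\<close>
  moreover have "\<bar>?r y - ?r z\<bar> < ?m"
  proof -
    have "0 \<le> ?r x \<and> ?r x < 2 * ?m" for x using assms by simp
    from this[of y] this[of z] half show ?thesis
      by (smt (verit))
  qed
  ultimately have "?r y - ?r z = 0"
    using dvd_imp_le_int[of "?r y - ?r z" ?m] assms by fastforce
  then have "[y + D + 1 = z + D + 1] (mod 2 * ?m)"
    by (simp add: cong_def)
  then show "[y = z] (mod 2 * ?m)"
    by (simp add: add.assoc cong_add_rcancel)
qed

text \<open>A permutation \<open>T\<close> of all vertex maps carries one set of homomorphisms onto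
  the other. For a homomorphism of either kind, short walks from \<open>r\<close> confine the
  offsets from the root value to a range where \<open>T\<close> is plain doubling, and there
  doubling both preserves and reflects adjacency.\<close>

lemma card_homs_circulant_eq:
  fixes D :: nat
  defines "n \<equiv> 2 * (2 * int D + 3)"
  assumes F: "pair_graph F" and r: "r \<in> pverts F"
    and walk: "\<And>u. u \<in> pverts F \<Longrightarrow> \<exists>p. pre_digraph.awalk (with_proj F) r p u \<and> length p \<le> D"
  shows "card (homs F n (circulant n 1)) = card (homs F n (circulant n 2))"
proof -
  interpret pair_graph F by fact
  let ?A = "pverts F \<rightarrow>\<^sub>E {0..<n}"
  \<comment> \<open>The root value stays fixed and the offsets from it are doubled, so
    \<open>a\<close> can be recovered from \<open>T a\<close> by reading \<open>a r\<close>
    first.\<close>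
  define T where "T a = (\<lambda>u\<in>pverts F. (a r + double_near D (a u - a r)) mod n)" for a
  have n: "n > 0" by (simp add: n_def)
  have finA: "finite ?A" by (intro finite_PiE) auto
  have TA: "T ` ?A \<subseteq> ?A" using n by (auto simp: T_def)
  have Tcong: "[T a u = a r + double_near D (a u - a r)] (mod n)" if "u \<in> pverts F" for a u
    using that by (simp add: T_def cong_def)
  have Tr: "[T a r = a r] (mod n)" for a
    using Tcong[OF r, of a] double_near_eq[of 0 "int D"] by simp
  have inj: "inj_on T ?A"
  proof (rule inj_onI)
    fix a b assume a: "a \<in> ?A" and b: "b \<in> ?A" and eq: "T a = T b"
    have red: "x = y" if "x \<in> {0..<n}" "y \<in> {0..<n}" "[x = y] (mod n)" for x y
      using that by (simp add: cong_def)
    have rr: "a r = b r"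
    proof (rule red)
      show "[a r = b r] (mod n)"
        using Tr[of a] Tr[of b] eq by (metis cong_sym cong_trans)
    qed (use a b r in auto)
    show "a = b"
    proof (rule PiE_ext[OF a b], rule red)
      fix u assume u: "u \<in> pverts F"
      have "[a r + double_near D (a u - a r) = a r + double_near D (b u - a r)] (mod n)"
        using Tcong[OF u, of a] Tcong[OF u, of b] eq rr by (metis cong_sym cong_trans)
      then have "[a u - a r = b u - a r] (mod n)"
        unfolding cong_add_lcancel n_def by (subst (asm) double_near_cong_iff) auto
      then show "[a u = b u] (mod n)"
        using cong_add_rcancel[of "a u" "- a r" "b u" n] by simp
    qed (use a b in auto)
  qed
  have hom_iff: "a \<in> homs F n (circulant n 1) \<longleftrightarrow> T a \<in> homs F n (circulant n 2)" if a: "a \<in> ?A" for a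
  proof -
    have edge: "circulant n 1 (a i) (a j) \<longleftrightarrow> circulant n 2 (T a i) (T a j)"
      if t: "\<bar>s\<bar> \<le> int D" "\<bar>t\<bar> \<le> int D"
        and ij: "[a i - a r = s] (mod n)" "[a j - a r = t] (mod n)" "i \<in> pverts F" "j \<in> pverts F" for i j s t
    proof -
      have T2: "[T a u = a r + 2 * t] (mod n)"
        if "\<bar>t\<bar> \<le> int D" "[a u - a r = t] (mod n)" "u \<in> pverts F" for u t
      proof -
        have "[double_near D (a u - a r) = double_near D t] (mod n)"
          using that(2) unfolding n_def by (subst double_near_cong_iff) auto
        then show ?thesis
          using Tcong[OF that(3), of a] that(1) by (metis cong_add_lcancel cong_trans double_near_eq)
      qed
      have a1: "[a u = a r + t] (mod n)" if "[a u - a r = t] (mod n)" for u t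
        using cong_add[OF cong_refl that, of "a r"] by simp
      have "circulant n 1 (a i) (a j) \<longleftrightarrow> circulant n 1 (a r + s) (a r + t)"
        by (rule circulant_cong) (use ij a1 in blast)+
      also have "\<dots> \<longleftrightarrow> n dvd s - t - 1 \<or> n dvd s - t + 1"
        by (simp add: circulant_def cong_iff_dvd_diff)
      \<comment> \<open>Both numbers have absolute value at most \<open>2 * D + 1\<close>, so
        divisibility by \<open>n\<close> or by its half means being zero. The half
        \<open>2 * D + 3\<close> is the least odd number above this bound.\<close>
      also have "\<dots> \<longleftrightarrow> 2 * int D + 3 dvd s - t - 1 \<or> 2 * int D + 3 dvd s - t + 1"
      proof -
        have small: "q dvd x \<longleftrightarrow> x = 0" if "\<bar>x\<bar> < q" for q x :: int
          using that dvd_imp_le_int[of x q] by force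
        have "\<bar>s - t - 1\<bar> < 2 * int D + 3" "\<bar>s - t + 1\<bar> < 2 * int D + 3"
          using t by linarith+
        moreover from this have "\<bar>s - t - 1\<bar> < n" "\<bar>s - t + 1\<bar> < n"
          by (simp_all add: n_def)
        ultimately show ?thesis by (simp only: small)
      qed
      also have "\<dots> \<longleftrightarrow> n dvd 2 * (s - t - 1) \<or> n dvd 2 * (s - t + 1)"
        unfolding n_def by (simp only: dvd_mult_cancel_left) simp
      also have "\<dots> \<longleftrightarrow> circulant n 2 (a r + 2 * s) (a r + 2 * t)"
        by (simp add: circulant_def cong_iff_dvd_diff algebra_simps)
      also have "\<dots> \<longleftrightarrow> circulant n 2 (T a i) (T a j)"
        by (rule circulant_cong) (use t ij T2 cong_sym in blast)+
      finally show ?thesis .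
    qed
    have near1: "\<exists>t. \<bar>t\<bar> \<le> int D \<and> [a u - a r = t] (mod n)"
      if hom: "\<forall>(i, j)\<in>parcs F. circulant n 1 (a i) (a j)" and u: "u \<in> pverts F" for u
    proof -
      obtain p where p: "awalk r p u" "length p \<le> D" using walk[OF u] by blast
      from circulant_hom_walk[OF p(1) hom] obtain t
        where "\<bar>t\<bar> \<le> int (length p)" "[a u - a r = 1 * t] (mod n)" by blast
      with p(2) show ?thesis by (intro exI[of _ t]) simp
    qed
    \<comment> \<open>The walk only bounds the offset of \<open>T a u\<close>, which is congruent to
      \<open>2 * t\<close>. Since this is \<open>double_near D t\<close>, injectivity of
      \<open>double_near\<close> pulls the bound back to \<open>a u\<close>.\<close>
    have near2: "\<exists>t. \<bar>t\<bar> \<le> int D \<and> [a u - a r = t] (mod n)"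
      if hom: "\<forall>(i, j)\<in>parcs F. circulant n 2 (T a i) (T a j)" and u: "u \<in> pverts F" for u
    proof -
      obtain p where p: "awalk r p u" "length p \<le> D" using walk[OF u] by blast
      from circulant_hom_walk[OF p(1) hom] obtain t
        where "\<bar>t\<bar> \<le> int (length p)" and t2: "[T a u - T a r = 2 * t] (mod n)" by blast
      with p(2) have t: "\<bar>t\<bar> \<le> int D" by simp
      have "[T a u - T a r = a r + double_near D (a u - a r) - a r] (mod n)"
        by (rule cong_diff[OF Tcong[OF u] Tr])
      then have "[double_near D (a u - a r) = double_near D t] (mod n)"
        using t2 unfolding double_near_eq[OF t] by (simp add: cong_def)
      then have "[a u - a r = t] (mod n)"
        unfolding n_def by (subst (asm) double_near_cong_iff) auto
      with t show ?thesis by blast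
    qed
    have "(\<forall>(i, j)\<in>parcs F. circulant n 1 (a i) (a j)) \<longleftrightarrow> (\<forall>(i, j)\<in>parcs F. circulant n 2 (T a i) (T a j))"
      (is "?H1 \<longleftrightarrow> ?H2")
    \<comment> \<open>Either side alone gives the bound on all offsets that \<open>edge\<close>
      requires; if both fail there is nothing to show.\<close>
    proof (cases "?H1 \<or> ?H2")
      case True
      then have near: "\<exists>t. \<bar>t\<bar> \<le> int D \<and> [a u - a r = t] (mod n)" if "u \<in> pverts F" for u
        using near1 near2 that by blast
      have "circulant n 1 (a i) (a j) \<longleftrightarrow> circulant n 2 (T a i) (T a j)" if "(i, j) \<in> parcs F" for i j
        using near[OF in_arcsD1[OF that]] near[OF in_arcsD2[OF that]] edge
          in_arcsD1[OF that] in_arcsD2[OF that] by blast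
      then show ?thesis by blast
    qed blast
    then show ?thesis
      using a TA by (auto simp: homs_def)
  qed
  have "T ` homs F n (circulant n 1) = homs F n (circulant n 2)"
  proof
    show "T ` homs F n (circulant n 1) \<subseteq> homs F n (circulant n 2)"
      using hom_iff by (auto simp: homs_def)
    show "homs F n (circulant n 2) \<subseteq> T ` homs F n (circulant n 1)"
    proof
      fix b assume b: "b \<in> homs F n (circulant n 2)"
      \<comment> \<open>An injective self-map of a finite set is surjective.\<close>
      then have "b \<in> T ` ?A"
        using endo_inj_surj[OF finA TA inj] by (simp add: homs_def)
      then obtain a where "a \<in> ?A" "b = T a" by blast
      then show "b \<in> T ` homs F n (circulant n 1)" using b hom_iff by blast
    qed
  qed
  moreover have "inj_on T (homs F n (circulant n 1))"
    by (rule inj_on_subset[OF inj]) (auto simp: homs_def)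
  ultimately show ?thesis
    by (metis card_image)
qed

section \<open>Short walks and the distinguishing odd cycle\<close>

text \<open>The distance is an infimum of walk lengths. An infimum strictly below
  \<open>D + 1\<close> yields a walk shorter than \<open>D + 1\<close>, and lengths are
  integers.\<close>

lemma (in pair_wf_digraph) short_walk:
  assumes "graph_diameter (with_proj G) \<le> ereal (real D)" "u \<in> pverts G" "v \<in> pverts G"
  shows "\<exists>p. awalk u p v \<and> length p \<le> D"
proof -
  have cost: "awalk_cost (\<lambda>_. 1) p = real (length p)" for p
    by (induction p) auto
  have "\<mu> (\<lambda>_. 1) u v \<le> (SUP v\<in>pverts G. \<mu> (\<lambda>_. 1) u v)"
    by (rule SUP_upper[OF assms(3)])
  also have "\<dots> \<le> (SUP u\<in>pverts G. SUP v\<in>pverts G. \<mu> (\<lambda>_. 1) u v)"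
    by (rule SUP_upper[OF assms(2)])
  also have "\<dots> \<le> ereal (real D)"
    using assms(1) by (simp add: graph_diameter_def)
  also have "\<dots> < ereal (real (Suc D))"
    by simp
  finally obtain p where "awalk u p v" "ereal (awalk_cost (\<lambda>_. 1) p) < ereal (real (Suc D))"
    unfolding \<mu>_def INF_less_iff by blast
  then show ?thesis
    using cost by (intro exI[of _ p]) simp
qed

text \<open>Vertices of different parts are adjacent, and vertices of the same part have the common
  neighbour \<open>x\<close> or \<open>y\<close> in the other, nonempty part.\<close>

lemma complete_bipartite_diameter:
  assumes "complete_bipartite_digraph k l (with_proj F)" "k \<ge> 1" "l \<ge> 1"
  shows "graph_diameter (with_proj F) \<le> 2"
proof -
  interpret pair_graph F
    using assms(1) by (rule pair_graphI_complete_bipartite)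
  obtain U V where UV: "pverts F = U \<union> V" "card U = k" "card V = l" "parcs F = U \<times> V \<union> V \<times> U"
    using assms(1) by (auto simp: complete_bipartite_digraph_pair_def)
  with assms(2,3) obtain x y where xy: "x \<in> U" "y \<in> V"
    by (metis card.empty ex_in_conv not_one_le_zero)
  have mu: "\<mu> (\<lambda>_. 1) u v \<le> 2" if p: "awalk u p v" "length p \<le> 2" for u p v
  proof -
    have cost: "awalk_cost (\<lambda>_. 1) p = real (length p)" for p
      by (induction p) auto
    have "\<mu> (\<lambda>_. 1) u v \<le> ereal (real (length p))"
      using min_cost_le_walk_cost[OF p(1), of "\<lambda>_. 1"] by (simp only: cost)
    also have "\<dots> \<le> 2" using p(2) by simp
    finally show ?thesis .
  qed
  have "\<mu> (\<lambda>_. 1) u v \<le> 2" if uv: "u \<in> pverts F" "v \<in> pverts F" for u v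
  proof -
    consider "(u, v) \<in> parcs F" | "(u, y) \<in> parcs F" "(y, v) \<in> parcs F" | "(u, x) \<in> parcs F" "(x, v) \<in> parcs F"
      using uv xy unfolding UV by blast
    then show ?thesis
    proof cases
      case 1
      then show ?thesis using that by (intro mu[of u "[(u, v)]"]) (auto simp: awalk_simps)
    next
      case 2
      then show ?thesis using that by (intro mu[of u "[(u, y), (y, v)]"]) (auto simp: awalk_simps)
    next
      case 3
      then show ?thesis using that by (intro mu[of u "[(u, x), (x, v)]"]) (auto simp: awalk_simps)
    qed
  qed
  then show ?thesis
    by (auto simp: graph_diameter_def intro!: SUP_least)
qed

section \<open>Odd cycles in the two circulant graphs\<close>

definition cycle_graph :: "nat \<Rightarrow> nat pair_pre_digraph" where
  "cycle_graph k = \<lparr>pverts = {1..k}, parcs = {(i, j). i \<in> {1..k} \<and> j \<in> {1..k} \<and>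
     (j = Suc i \<or> i = Suc j \<or> i = 1 \<and> j = k \<or> i = k \<and> j = 1)}\<rparr>"

lemma pverts_cycle_graph [simp]: "pverts (cycle_graph k) = {1..k}"
  by (simp add: cycle_graph_def)

text \<open>For \<open>k = 1\<close> the closing arc would be a loop.\<close>

lemma pair_graph_cycle_graph:
  assumes "k \<ge> 2"
  shows "pair_graph (cycle_graph k)"
proof
  show "finite (parcs (cycle_graph k))"
    by (rule finite_subset[of _ "{1..k} \<times> {1..k}"]) (auto simp: cycle_graph_def)
  show "symmetric (with_proj (cycle_graph k))"
    by (auto simp: symmetric_def sym_def cycle_graph_def)
qed (use assms in \<open>auto simp: cycle_graph_def\<close>)

text \<open>For even \<open>n\<close> parity is well defined on residues and every arc flips it, so
  the target is bipartite.\<close>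

lemma no_homs_odd_cycle:
  assumes n: "even n" and k: "odd k"
  shows "homs (cycle_graph k) n (circulant n 1) = {}"
proof (rule equals0I)
  fix a assume "a \<in> homs (cycle_graph k) n (circulant n 1)"
  then have hom: "circulant n 1 (a i) (a j)" if "(i, j) \<in> parcs (cycle_graph k)" for i j
    using that by (auto simp: homs_def)
  have parity: "even (a i) \<longleftrightarrow> odd (a j)" if "(i, j) \<in> parcs (cycle_graph k)" for i j
  proof -
    have "n dvd a i - a j - 1 \<or> n dvd a i - a j + 1"
      using hom[OF that] by (simp add: circulant_def cong_iff_dvd_diff)
    then have "even (a i - a j - 1) \<or> even (a i - a j + 1)"
      using n dvd_trans by blast
    then show ?thesis by auto
  qed
  have "even (a (Suc i)) \<longleftrightarrow> even (a 1) = even i" if "Suc i \<le> k" for i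
    using that
  proof (induction i)
    case (Suc i)
    then have "(Suc i, Suc (Suc i)) \<in> parcs (cycle_graph k)"
      by (auto simp: cycle_graph_def)
    from parity[OF this] Suc show ?case by auto
  qed simp
  \<comment> \<open>The path from 1 to \<open>k\<close> has an even number of arcs, so its ends have
    equal parity, while the closing arc demands opposite parities.\<close>
  from this[of "k - 1"] have "even (a k) \<longleftrightarrow> even (a 1)"
    using k by (cases k) auto
  moreover have "(1, k) \<in> parcs (cycle_graph k)"
    using k by (cases k) (auto simp: cycle_graph_def)
  ultimately show False
    using parity by blast
qed

text \<open>The map \<open>i\<close> to \<open>2 * i\<close> runs once through the even residues;
  the closing arc fits because \<open>2 * k\<close> vanishes modulo \<open>2 * k\<close>.\<close>

lemma homs_cycle_circulant_2:
  assumes "k \<ge> 1"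
  shows "homs (cycle_graph k) (2 * int k) (circulant (2 * int k) 2) \<noteq> {}"
proof -
  define a where "a = (\<lambda>i\<in>{1..k}. (2 * int i) mod (2 * int k))"
  have "circulant (2 * int k) 2 (a i) (a j)" if ij: "(i, j) \<in> parcs (cycle_graph k)" for i j
  proof -
    have "circulant (2 * int k) 2 (a i) (a j) \<longleftrightarrow> circulant (2 * int k) 2 (2 * int i) (2 * int j)"
      by (rule circulant_cong) (use ij in \<open>auto simp: a_def cycle_graph_def cong_def\<close>)
    also have "\<dots>"
      using ij by (auto simp: circulant_def cycle_graph_def cong_iff_dvd_diff algebra_simps)
    finally show ?thesis .
  qed
  moreover have "a \<in> {1..k} \<rightarrow>\<^sub>E {0..<2 * int k}"
    using assms by (auto simp: a_def)
  ultimately have "a \<in> homs (cycle_graph k) (2 * int k) (circulant (2 * int k) 2)"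
    by (auto simp: homs_def)
  then show ?thesis by blast
qed

section \<open>Equal densities against the distinguishing cycle\<close>

lemma not_forcing_bounded_diameter:
  fixes D :: nat
  shows "\<not> forcing {F. pair_graph F \<and> graph_diameter (with_proj F) \<le> ereal (real D)}"
proof
  define k where "k = 2 * D + 3"
  define n where "n = 2 * int k"
  let ?W = "\<lambda>s. step_graphon n (circulant n s)"
  let ?C = "cycle_graph k"
  have n: "n > 0" "n = 2 * (2 * int D + 3)" by (simp_all add: n_def k_def)
  have W: "graphon (?W s)" for s
    by (rule graphon_step_graphon[OF symp_circulant])
  have C: "pair_graph ?C"
    by (rule pair_graph_cycle_graph) (simp add: k_def)
  assume forc: "forcing {F. pair_graph F \<and> graph_diameter (with_proj F) \<le> ereal (real D)}"
  have "hom_density F (?W 1) = hom_density F (?W 2)"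
    if F: "pair_graph F" and diam: "graph_diameter (with_proj F) \<le> ereal (real D)" for F
  proof -
    interpret pair_graph F by fact
    have "card (homs F n (circulant n 1)) = card (homs F n (circulant n 2))"
    \<comment> \<open>The empty graph also belongs to the family, since its diameter is a supremum
      over the empty set; it has no root, but both sets consist of the empty map only.\<close>
    proof (cases "pverts F = {}")
      case True
      then have "parcs F = {}" using in_arcsD1 by fast
      then show ?thesis by (simp add: homs_def)
    next
      case False
      then obtain r where "r \<in> pverts F" by blast
      then show ?thesis
        unfolding n(2) using short_walk[OF diam] by (intro card_homs_circulant_eq[OF F]) auto
    qed
    then show ?thesis
      by (simp add: hom_density_step_graphon[OF F symp_circulant n(1)])
  qed
  with forc have "weakly_isomorphic (?W 1) (?W 2)"
    using W unfolding forcing_def by blast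
  then have "hom_density ?C (?W 1) = hom_density ?C (?W 2)"
    by (rule weakly_isomorphic_hom_density[OF _ W W C, where k = k]) simp
  then have "card (homs ?C n (circulant n 1)) = card (homs ?C n (circulant n 2))"
    using n(1) by (simp add: hom_density_step_graphon[OF C symp_circulant n(1)])
  moreover have "homs ?C n (circulant n 1) = {}"
    by (rule no_homs_odd_cycle) (simp_all add: n_def k_def)
  moreover have "homs ?C n (circulant n 2) \<noteq> {}"
    unfolding n_def by (rule homs_cycle_circulant_2) (simp add: k_def)
  moreover have "finite (homs ?C n (circulant n 2))"
    by (rule finite_subset[of _ "{1..k} \<rightarrow>\<^sub>E {0..<n}"]) (auto simp: homs_def intro: finite_PiE)
  ultimately show False
    by simp
qed

lemma forcing_mono: "forcing \<F> \<Longrightarrow> \<F> \<subseteq> \<G> \<Longrightarrow> forcing \<G>"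
  unfolding forcing_def by blast

theorem proposition9:
  shows "(\<forall>d::int. \<not> forcing {F. pair_graph F \<and> graph_diameter (with_proj F) \<le> ereal (real_of_int d)}) \<and>
    \<not> forcing {F. \<exists>k\<ge>1. \<exists>l\<ge>1. complete_bipartite_digraph k l (with_proj F)}"
proof (intro conjI allI)
  fix d :: int
  let ?\<F> = "\<lambda>d. {F :: nat pair_pre_digraph. pair_graph F \<and> graph_diameter (with_proj F) \<le> ereal d}"
  \<comment> \<open>A subfamily of a non-forcing family is non-forcing, and for negative
    \<open>d\<close> the bound may be raised to \<open>nat d = 0\<close>.\<close>
  have "?\<F> (real_of_int d) \<subseteq> ?\<F> (real (nat d))"
    by (auto elim!: order_trans)
  then show "\<not> forcing (?\<F> (real_of_int d))"
    using not_forcing_bounded_diameter forcing_mono by blast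
next
  let ?\<B> = "{F :: nat pair_pre_digraph. \<exists>k\<ge>1. \<exists>l\<ge>1. complete_bipartite_digraph k l (with_proj F)}"
  have "?\<B> \<subseteq> {F. pair_graph F \<and> graph_diameter (with_proj F) \<le> ereal (real 2)}"
    using complete_bipartite_diameter by (auto intro: pair_graphI_complete_bipartite)
  then show "\<not> forcing ?\<B>"
    using not_forcing_bounded_diameter forcing_mono by blast
qed

end
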